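(* Let $r\le n$ be positive integers, and let $k$ be a positive integer such that $k\le \frac{n}{r+1}$. Then the following identities hold: 1. $i_k(P_n^r,q)=\begin{bmatrix} n-rk+r\\ k\end{bmatrix}$, 2. $i_k(C_n^r,q)=\frac{[rk]}{[k]}\,i_{k-1}(P_{n-1-2r}^r,q)+q^{rk}\,i_k(P_{n-r}^r,q)$, 3. $i_k(C_n^r,q)=\frac{[n]}{[n-rk]}\begin{bmatrix} n-rk\\ k\end{bmatrix}$.
   Context: $[m]=1+q+\cdots+q^{m-1}$, and $\begin{bmatrix} a\\ b\end{bmatrix}=\frac{[a]!}{[b]!\,[a-b]!}$ for $0\le b\le a$ (with $[m]!=[1][2]\cdots[m]$) is the $q$-binomial coefficient. $C_n^r$ is the $r$th power of the cycle graph: vertex set $\{0,\ldots,n-1\}$ and edges $j\sim (j+\ell)\bmod n$ for all $j\in\{0,\ldots,n-1\}$ and $\ell\in\{1,\ldots,r\}$. $P_m^r$ is the $r$th power of the path graph: vertex set $\{0,\ldots,m-1\}$ and edges $i\sim i+j$ for $1\le j\le r$ whenever $i$ and $i+j$ are both in $\{0,\ldots,m-1\}$; for $m\le 0$, $P_m^r$ is the graph with no vertices. Let $\mathcal{I}_k(G)$ denote the collection of independent sets of size $k$ of a graph $G$. For a finite set $A$ of nonnegative integers with $|A|=k$ define $$\mathrm{sum}_r(A)=-(r+1)\binom{k}{2}+\sum_{a\in A}a.$$ With the given $r$ fixed throughout, for a graph $G$ whose vertex set is $\{0,\ldots,m-1\}$ for some $m$, define the (a priori Laurent) polynomial $$i_k(G,q)=\sum_{A\in\mathcal{I}_k(G)}q^{\mathrm{sum}_r(A)}.$$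 In particular $i_0(G,q)=1$ for every such $G$, including the graph with no vertices. *)

theory Defs
  imports "HOL-Library.Ramsey" "HOL-Computational_Algebra.Polynomial"
    "HOL-Computational_Algebra.Fraction_Field"
begin

text \<open>
  All identities live in the field \<open>\<rat>(q)\<close>, represented as the fraction field of \<open>\<int>[q]\<close>, with
  \<open>qvar\<close> the indeterminate. It contains the Laurent polynomials over the integers, and
  quotients of \<open>q\<close>-integers are honest divisions in it.
\<close>

definition qvar :: "int poly fract" where
  "qvar = Fraction_Field.Fract [:0, 1:] 1"

definition q_int :: "'a::field \<Rightarrow> nat \<Rightarrow> 'a" where
  "q_int q m = (\<Sum>j<m. q ^ j)"

definition q_fact :: "'a::field \<Rightarrow> nat \<Rightarrow> 'a" where
  "q_fact q m = (\<Prod>j=1..m. q_int q j)"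

text \<open>Only meaningful for \<open>b \<le> a\<close>; the truncated subtraction yields a junk value otherwise.\<close>

definition q_binomial :: "'a::field \<Rightarrow> nat \<Rightarrow> nat \<Rightarrow> 'a" where
  "q_binomial q a b = q_fact q a / (q_fact q b * q_fact q (a - b))"

text \<open>
  A graph is a pair of its vertex set and its set of edges, an edge being the set of its
  two endpoints (the convention of \<^const>\<open>indep\<close>).
\<close>

type_synonym 'a graph = "'a set \<times> 'a set set"

definition cycle_power :: "nat \<Rightarrow> nat \<Rightarrow> nat graph" where
  "cycle_power r n = ({0..<n}, {{j, (j + l) mod n} | j l. j \<in> {0..<n} \<and> l \<in> {1..r}})"

text \<open>The number of vertices is an integer: for \<open>m \<le> 0\<close> this is the graph with no vertices.\<close>

definition path_power :: "nat \<Rightarrow> int \<Rightarrow> nat graph" where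
  "path_power r m =
    ({0..<nat m}, {{i, i + j} | i j. j \<in> {1..r} \<and> i \<in> {0..<nat m} \<and> i + j \<in> {0..<nat m}})"

definition independent_sets :: "'a graph \<Rightarrow> nat \<Rightarrow> 'a set set" where
  "independent_sets G k = {A \<in> nsets (fst G) k. indep A (snd G)}"

definition sum_r :: "nat \<Rightarrow> nat set \<Rightarrow> int" where
  "sum_r r A = - (int r + 1) * int (card A choose 2) + (\<Sum>a\<in>A. int a)"

definition indep_poly :: "nat \<Rightarrow> nat \<Rightarrow> nat graph \<Rightarrow> 'a::field \<Rightarrow> 'a" where
  "indep_poly r k G q = (\<Sum>A\<in>independent_sets G k. q powi sum_r r A)"

end

theory Submission
  imports Defs
begin

text \<open>
  An independent set of a path power is a set of integers whose distinct elements are more than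
  \<open>r\<close> apart. Classify the \<open>(k+1)\<close>-element ones below \<open>m + 1\<close> by whether they contain the
  largest vertex \<open>m\<close>: if they do, the other elements form such a set below \<open>m - r\<close>, and \<open>m\<close>
  contributes the exponent \<open>m - (r+1) k\<close>. This is exactly the \<open>q\<close>-Pascal recursion, whence the
  first identity (\<open>indep_poly_path\<close>). The term with the binomial coefficient in \<^const>\<open>sum_r\<close> is
  the least element sum of a \<open>k\<close>-element set with such gaps, so no negative exponent survives.

  In the cycle power, an independent set also has to keep its elements more than \<open>r\<close> apart across
  the boundary between \<open>n - 1\<close> and \<open>0\<close>. Since the vertices \<open>0, \<dots>, r - 1\<close> form a clique, at most
  one of them is used. If none is, the set is an independent set of \<open>P\<^bsub>n-r\<^esub>\<close> shifted by \<open>r\<close>,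
  which gives the factor \<open>q\<^bsup>rk\<^esup>\<close>. If \<open>c < r\<close> is used, the other elements lie strictly between
  \<open>c + r\<close> and \<open>n + c - r\<close>: a copy of \<open>P\<^bsub>n-1-2r\<^esub>\<close> shifted by \<open>c + r + 1\<close>. The shift and the
  normalisation in \<^const>\<open>sum_r\<close> combine to the factor \<open>q\<^bsup>ck\<^esup>\<close>, and summing the geometric
  progression over \<open>c\<close> gives \<open>[rk] / [k]\<close>. This is the second identity (\<open>indep_poly_cycle\<close>).

  Substitute the first identity into the second, with \<open>N = n - rk\<close>, and absorb the factor
  \<open>1 / [k]\<close> by raising both entries of the first coefficient by one (\<open>q_binomial_absorb\<close>). This leaves
  \<open>([rk] + q\<^bsup>rk\<^esup> [N]) / [N]\<close> times the \<open>q\<close>-binomial coefficient of \<open>N\<close> over \<open>k\<close>, and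
  \<open>[rk] + q\<^bsup>rk\<^esup> [N] = [n]\<close>.
\<close>

section \<open>Gaussian binomial coefficients\<close>

lemma q_int_add: "q_int q (a + b) = q_int q a + q ^ a * q_int q b"
proof -
  have "q_int q (a + b) = (\<Sum>j<a. q ^ j) + (\<Sum>j=a..<a + b. q ^ j)"
    unfolding q_int_def lessThan_atLeast0 by (rule sum.atLeastLessThan_concat [symmetric]) auto
  also have "(\<Sum>j=a..<a + b. q ^ j) = (\<Sum>j<b. q ^ (a + j))"
    using sum.shift_bounds_nat_ivl [of "\<lambda>j. q ^ j" 0 a b]
    by (simp add: lessThan_atLeast0 add.commute)
  finally show ?thesis
    by (simp add: q_int_def power_add sum_distrib_left)
qed

lemma q_int_mult_geometric: "q_int q k * (\<Sum>c<r. q ^ (c * k)) = q_int q (r * k)"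
proof (induction r)
  case 0
  show ?case by (simp add: q_int_def)
next
  case (Suc r)
  have "q_int q (r * k + k) = q_int q (r * k) + q ^ (r * k) * q_int q k"
    by (rule q_int_add)
  with Suc show ?case
    by (simp add: algebra_simps)
qed

lemma q_fact_0 [simp]: "q_fact q 0 = 1"
  by (simp add: q_fact_def)

lemma q_fact_Suc [simp]: "q_fact q (Suc m) = q_fact q m * q_int q (Suc m)"
  by (simp add: q_fact_def)

text \<open>
  Extending the Gaussian coefficient by zero beyond the diagonal makes the \<open>q\<close>-Pascal recursion
  hold without side conditions, and it is the right value: no \<open>k\<close>-element set with the required
  gaps fits into a path that is too short.
\<close>

definition gauss :: "'a::field \<Rightarrow> nat \<Rightarrow> nat \<Rightarrow> 'a" where
  "gauss q a b = (if b \<le> a then q_binomial q a b else 0)"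

context
  fixes q :: "'a::field"
  assumes q_int_nonzero: "0 < m \<Longrightarrow> q_int q m \<noteq> 0"
begin

lemma q_fact_nonzero: "q_fact q m \<noteq> 0"
  by (simp add: q_fact_def q_int_nonzero)

lemma gauss_0_right: "gauss q a 0 = 1"
  by (simp add: gauss_def q_binomial_def q_fact_nonzero)

lemma q_binomial_absorb:
  "q_int q (Suc b) * q_binomial q (Suc a) (Suc b) = q_int q (Suc a) * q_binomial q a b"
  using q_int_nonzero [of "Suc b"] by (simp add: q_binomial_def)

lemma gauss_Suc_Suc:
  "gauss q (Suc a) (Suc b) = gauss q a (Suc b) + q ^ (a - b) * gauss q a b"
proof -
  consider "a < b" | "a = b" | d where "a = Suc (b + d)"
    by (metis less_imp_Suc_add linorder_less_linear)
  then show ?thesis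
  proof cases
    case 1
    then show ?thesis by (simp add: gauss_def)
  next
    case 2
    then show ?thesis
      using q_fact_nonzero [of b] q_int_nonzero [of "Suc b"]
      by (simp add: gauss_def q_binomial_def)
  next
    case (3 d)
    \<comment> \<open>\<open>[a + 1]\<close> is split as \<open>[a - b] + q\<^bsup>a-b\<^esup> [b + 1]\<close>, one summand per term.\<close>
    have split: "q_int q (Suc a) = q_int q (Suc d) + q ^ Suc d * q_int q (Suc b)"
      using q_int_add [of q "Suc d" "Suc b"] 3 by (simp add: add_ac)
    have left: "gauss q a (Suc b) = q_fact q a * q_int q (Suc d) /
        (q_fact q (Suc b) * q_fact q (Suc d))"
      using 3 q_int_nonzero [of "Suc d"] by (simp add: gauss_def q_binomial_def)
    have right: "gauss q a b = q_fact q a * q_int q (Suc b) /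
        (q_fact q (Suc b) * q_fact q (Suc d))"
      using 3 q_int_nonzero [of "Suc b"] by (simp add: gauss_def q_binomial_def Suc_diff_le)
    have "gauss q (Suc a) (Suc b) = q_fact q a * q_int q (Suc a) /
        (q_fact q (Suc b) * q_fact q (Suc d))"
      using 3 by (simp add: gauss_def q_binomial_def)
    moreover have "a - b = Suc d"
      using 3 by simp
    ultimately show ?thesis
      unfolding left right split by (simp only: times_divide_eq_right add_divide_distrib [symmetric])
        (simp add: algebra_simps)
  qed
qed

end

section \<open>The weight of a vertex set\<close>

lemma sum_r_empty [simp]: "sum_r r {} = 0"
  by (simp add: sum_r_def)

lemma sum_r_insert:
  assumes "finite A" "x \<notin> A"
  shows "sum_r r (insert x A) = sum_r r A + int x - (int r + 1) * int (card A)"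
  using assms by (simp add: sum_r_def numeral_2_eq_2 algebra_simps)

lemma sum_r_shift:
  assumes "finite A"
  shows "sum_r r ((+) c ` A) = sum_r r A + int c * int (card A)"
  using assms by (simp add: sum_r_def card_image sum.reindex sum.distrib)

section \<open>Independent sets of path powers\<close>

definition spaced_sets :: "nat \<Rightarrow> nat \<Rightarrow> nat \<Rightarrow> nat set set" where
  "spaced_sets r m k = {A. A \<subseteq> {0..<m} \<and> card A = k \<and> (\<forall>x\<in>A. \<forall>y\<in>A. x < y \<longrightarrow> x + r < y)}"

lemma finite_spaced_sets: "finite (spaced_sets r m k)"
  by (rule finite_subset [of _ "Pow {0..<m}"]) (auto simp: spaced_sets_def)

lemma finite_mem_spaced_sets: "A \<in> spaced_sets r m k \<Longrightarrow> finite A"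
  by (auto simp: spaced_sets_def intro: finite_subset)

lemma spaced_sets_0_right: "spaced_sets r m 0 = {{}}"
  by (auto simp: spaced_sets_def dest: finite_subset)

lemma spaced_sets_0_Suc: "spaced_sets r 0 (Suc k) = {}"
  by (auto simp: spaced_sets_def)

lemma path_power_edge_iff:
  assumes "x < y" "y < nat m"
  shows "{x, y} \<in> snd (path_power r m) \<longleftrightarrow> y \<le> x + r"
proof
  assume "y \<le> x + r"
  with assms have "{x, y} = {x, x + (y - x)} \<and> y - x \<in> {1..r} \<and> x \<in> {0..<nat m} \<and>
      x + (y - x) \<in> {0..<nat m}"
    by auto
  then show "{x, y} \<in> snd (path_power r m)"
    unfolding path_power_def snd_conv by blast
next
  assume "{x, y} \<in> snd (path_power r m)"
  with assms show "y \<le> x + r"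
    by (auto simp: path_power_def doubleton_eq_iff)
qed

lemma indep_linear_iff:
  fixes A :: "'a::linorder set"
  shows "indep A E \<longleftrightarrow> (\<forall>x\<in>A. \<forall>y\<in>A. x < y \<longrightarrow> {x, y} \<notin> E)"
  unfolding indep_def by (metis insert_commute neq_iff)

lemma independent_sets_path: "independent_sets (path_power r m) k = spaced_sets r (nat m) k"
proof -
  have "indep A (snd (path_power r m)) \<longleftrightarrow> (\<forall>x\<in>A. \<forall>y\<in>A. x < y \<longrightarrow> x + r < y)"
    if "A \<subseteq> {0..<nat m}" for A
    unfolding indep_linear_iff
  proof (intro ball_cong refl)
    fix x y assume "x \<in> A" "y \<in> A"
    with that have "y < nat m" by auto
    then show "(x < y \<longrightarrow> {x, y} \<notin> snd (path_power r m)) \<longleftrightarrow> (x < y \<longrightarrow> x + r < y)"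
      by (auto simp: path_power_edge_iff)
  qed
  moreover have "fst (path_power r m) = {0..<nat m}"
    by (simp add: path_power_def)
  ultimately show ?thesis
    by (auto simp: independent_sets_def spaced_sets_def nsets_def dest: finite_subset)
qed

lemma indep_poly_path_eq_sum:
  "indep_poly r k (path_power r m) q = (\<Sum>A\<in>spaced_sets r (nat m) k. q powi sum_r r A)"
  by (simp add: indep_poly_def independent_sets_path)

text \<open>
  Splitting off the largest vertex \<open>m\<close>. For \<open>m < r\<close> the truncated difference is still right: no
  other vertex is compatible with \<open>m\<close>.
\<close>

lemma spaced_sets_Suc_Suc:
  "spaced_sets r (Suc m) (Suc k) = spaced_sets r m (Suc k) \<union> insert m ` spaced_sets r (m - r) k"
proof (intro equalityI subsetI)
  fix A assume A: "A \<in> spaced_sets r (Suc m) (Suc k)"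
  show "A \<in> spaced_sets r m (Suc k) \<union> insert m ` spaced_sets r (m - r) k"
  proof (cases "m \<in> A")
    case False
    with A have "A \<in> spaced_sets r m (Suc k)"
      by (force simp: spaced_sets_def less_Suc_eq)
    then show ?thesis ..
  next
    case True
    have below: "x < m - r" if "x \<in> A - {m}" for x
    proof -
      from that A have "x < Suc m" "x \<noteq> m"
        by (auto simp: spaced_sets_def)
      with that A True have "x + r < m"
        by (auto simp: spaced_sets_def)
      then show ?thesis by simp
    qed
    have "A - {m} \<subseteq> {0..<m - r}"
      by (intro subsetI) (simp add: below)
    with A True finite_mem_spaced_sets [OF A] have "A - {m} \<in> spaced_sets r (m - r) k"
      by (simp add: spaced_sets_def)
    then show ?thesis
      using True by (metis UnI2 image_eqI insert_Diff)
  qed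
next
  fix A assume "A \<in> spaced_sets r m (Suc k) \<union> insert m ` spaced_sets r (m - r) k"
  then show "A \<in> spaced_sets r (Suc m) (Suc k)"
  proof
    assume "A \<in> spaced_sets r m (Suc k)"
    then show ?thesis
      by (force simp: spaced_sets_def)
  next
    assume "A \<in> insert m ` spaced_sets r (m - r) k"
    then obtain B where B: "B \<in> spaced_sets r (m - r) k" "A = insert m B"
      by auto
    have below: "x + r < m" if "x \<in> B" for x
      using that B(1) by (force simp: spaced_sets_def)
    then have "m \<notin> B"
      by fastforce
    then have "card A = Suc k"
      using B finite_mem_spaced_sets [OF B(1)] by (simp add: spaced_sets_def)
    moreover have "x < Suc m" if "x \<in> A" for x
      using that below [of x] B(2) by auto
    moreover have "x + r < y" if "x \<in> A" "y \<in> A" "x < y" for x y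
      using that below [of x] below [of y] B by (auto simp: spaced_sets_def)
    ultimately show ?thesis
      by (simp add: spaced_sets_def subset_iff)
  qed
qed

lemma sum_spaced_sets_Suc_Suc:
  fixes q :: "'a::field"
  assumes "q \<noteq> 0"
  shows "(\<Sum>A\<in>spaced_sets r (Suc m) (Suc k). q powi sum_r r A) =
    (\<Sum>A\<in>spaced_sets r m (Suc k). q powi sum_r r A) +
    q powi (int m - (int r + 1) * int k) * (\<Sum>A\<in>spaced_sets r (m - r) k. q powi sum_r r A)"
proof -
  have notin: "m \<notin> A" if "A \<in> spaced_sets r m' k'" "m' \<le> m" for A m' k'
    using that by (auto simp: spaced_sets_def)
  have "(\<Sum>A\<in>insert m ` spaced_sets r (m - r) k. q powi sum_r r A) =
      (\<Sum>A\<in>spaced_sets r (m - r) k. q powi sum_r r (insert m A))"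
    by (intro sum.reindex [unfolded o_def] inj_onI) (metis insert_ident notin diff_le_self)
  also have "\<dots> = (\<Sum>A\<in>spaced_sets r (m - r) k.
      q powi (int m - (int r + 1) * int k) * q powi sum_r r A)"
  proof (rule sum.cong [OF refl])
    fix A assume A: "A \<in> spaced_sets r (m - r) k"
    then have "card A = k" "m \<notin> A"
      by (auto simp: spaced_sets_def)
    then have "sum_r r (insert m A) = (int m - (int r + 1) * int k) + sum_r r A"
      using finite_mem_spaced_sets [OF A] by (simp add: sum_r_insert)
    then show "q powi sum_r r (insert m A) =
        q powi (int m - (int r + 1) * int k) * q powi sum_r r A"
      by (simp only: power_int_add [OF disjI1 [OF assms]])
  qed
  finally have img: "(\<Sum>A\<in>insert m ` spaced_sets r (m - r) k. q powi sum_r r A) =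
      q powi (int m - (int r + 1) * int k) * (\<Sum>A\<in>spaced_sets r (m - r) k. q powi sum_r r A)"
    by (simp add: sum_distrib_left)
  have "spaced_sets r m (Suc k) \<inter> insert m ` spaced_sets r (m - r) k = {}"
    using notin [OF _ order_refl] by auto
  then show ?thesis
    unfolding spaced_sets_Suc_Suc img [symmetric]
    by (intro sum.union_disjoint finite_spaced_sets finite_imageI)
qed

lemma sum_spaced_sets:
  fixes q :: "'a::field"
  assumes q: "q \<noteq> 0" and q_int_nonzero: "\<And>j. 0 < j \<Longrightarrow> q_int q j \<noteq> 0"
  shows "(\<Sum>A\<in>spaced_sets r m k. q powi sum_r r A) = gauss q (m + r - r * k) k"
proof (induction m arbitrary: k rule: less_induct)
  case (less m)
  consider "k = 0" | k' where "m = 0" "k = Suc k'" | m' k' where "m = Suc m'" "k = Suc k'"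
    by (metis not0_implies_Suc)
  then show ?case
  proof cases
    case 1
    then show ?thesis
      by (simp add: spaced_sets_0_right gauss_0_right [OF q_int_nonzero])
  next
    case (2 k')
    then show ?thesis
      by (simp add: spaced_sets_0_Suc gauss_def)
  next
    case (3 m' k')
    let ?N = "m' - r * k'"
    have rec: "(\<Sum>A\<in>spaced_sets r m k. q powi sum_r r A) = gauss q ?N (Suc k') +
        q powi (int m' - (int r + 1) * int k') * gauss q (m' - r + r - r * k') k'"
      using less [of m' "Suc k'"] less [of "m' - r" k'] 3
      by (simp add: sum_spaced_sets_Suc_Suc [OF q])
    show ?thesis
    proof (cases "r * k' + k' \<le> m'")
      case True
      then have "gauss q (m' - r + r - r * k') k' = gauss q ?N k'"
        by (cases k') (auto simp: gauss_0_right [OF q_int_nonzero])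
      moreover have "int m' - (int r + 1) * int k' = int (?N - k')"
        using True by (simp add: of_nat_diff algebra_simps)
      then have "q powi (int m' - (int r + 1) * int k') = q ^ (?N - k')"
        by (simp only: power_int_of_nat)
      moreover have "m + r - r * k = Suc ?N"
        using True 3 by simp
      ultimately show ?thesis
        using rec 3 by (simp add: gauss_Suc_Suc [OF q_int_nonzero])
    next
      case False
      then have "k' \<noteq> 0"
        by (cases k') auto
      with False have "?N < k'"
        by linarith
      moreover have "m' - r + r - r * k' < k'"
        using False \<open>k' \<noteq> 0\<close> by (cases "r \<le> m'"; cases k') auto
      moreover have "m + r - r * k < k"
        using False 3 \<open>k' \<noteq> 0\<close> by auto
      ultimately show ?thesis
        using rec by (simp add: gauss_def)
    qed
  qed
qed

theorem indep_poly_path: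
  fixes q :: "'a::field"
  assumes "q \<noteq> 0" and "\<And>j. 0 < j \<Longrightarrow> q_int q j \<noteq> 0" and "r * k + k \<le> m + r"
  shows "indep_poly r k (path_power r (int m)) q = q_binomial q (m + r - r * k) k"
  using assms(3) by (simp add: indep_poly_path_eq_sum sum_spaced_sets [OF assms(1,2)] gauss_def)

section \<open>Independent sets of cycle powers\<close>

lemma cycle_power_edge_iff:
  assumes "r < n" "x < y" "y < n"
  shows "{x, y} \<in> snd (cycle_power r n) \<longleftrightarrow> y \<le> x + r \<or> n + x \<le> y + r"
proof
  assume "y \<le> x + r \<or> n + x \<le> y + r"
  then show "{x, y} \<in> snd (cycle_power r n)"
  proof
    assume "y \<le> x + r"
    with assms have "{x, y} = {x, (x + (y - x)) mod n} \<and> x \<in> {0..<n} \<and> y - x \<in> {1..r}"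
      by auto
    then show ?thesis
      unfolding cycle_power_def snd_conv by blast
  next
    assume "n + x \<le> y + r"
    moreover have "(y + (n + x - y)) mod n = x"
      using assms by simp
    ultimately have "{x, y} = {y, (y + (n + x - y)) mod n} \<and> y \<in> {0..<n} \<and> n + x - y \<in> {1..r}"
      using assms by auto
    then show ?thesis
      unfolding cycle_power_def snd_conv by blast
  qed
next
  assume "{x, y} \<in> snd (cycle_power r n)"
  then obtain j l where jl: "{x, y} = {j, (j + l) mod n}" "j < n" "1 \<le> l" "l \<le> r"
    by (auto simp: cycle_power_def)
  have "(j + l) mod n = (if j + l < n then j + l else j + l - n)"
    using jl assms by (simp add: mod_if)
  with jl assms show "y \<le> x + r \<or> n + x \<le> y + r"
    by (auto simp: doubleton_eq_iff split: if_splits)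
qed

lemma independent_sets_cycle:
  assumes "r < n"
  shows "independent_sets (cycle_power r n) k =
    {A \<in> spaced_sets r n k. \<forall>x\<in>A. \<forall>y\<in>A. x < y \<longrightarrow> y + r < n + x}"
proof -
  have "indep A (snd (cycle_power r n)) \<longleftrightarrow>
      (\<forall>x\<in>A. \<forall>y\<in>A. x < y \<longrightarrow> x + r < y \<and> y + r < n + x)" if "A \<subseteq> {0..<n}" for A
    unfolding indep_linear_iff
  proof (intro ball_cong refl)
    fix x y assume "x \<in> A" "y \<in> A"
    with that have "y < n" by auto
    with assms show "(x < y \<longrightarrow> {x, y} \<notin> snd (cycle_power r n)) \<longleftrightarrow>
        (x < y \<longrightarrow> x + r < y \<and> y + r < n + x)"
      by (auto simp: cycle_power_edge_iff)
  qed
  moreover have "fst (cycle_power r n) = {0..<n}"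
    by (simp add: cycle_power_def)
  ultimately show ?thesis
    by (auto simp: independent_sets_def spaced_sets_def nsets_def dest: finite_subset)
qed

lemma card_shift: "card ((+) (c::nat) ` A) = card A"
  by (simp add: card_image)

lemma shift_unshift_image:
  fixes c :: nat
  assumes "\<forall>x\<in>A. c \<le> x"
  shows "(+) c ` (\<lambda>x. x - c) ` A = A"
  using assms by (force simp: image_image)

text \<open>
  Without a vertex below \<open>r\<close> the wrap-around condition is automatic, because all elements lie in a
  window of \<open>n - r\<close> consecutive vertices.
\<close>

lemma sum_cycle_avoiding_initial:
  fixes q :: "'a::field"
  assumes "r < n" "q \<noteq> 0"
  shows "(\<Sum>A | A \<in> independent_sets (cycle_power r n) k \<and> A \<inter> {..<r} = {}. q powi sum_r r A) =
    q ^ (r * k) * (\<Sum>B\<in>spaced_sets r (n - r) k. q powi sum_r r B)"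
  unfolding sum_distrib_left
proof (rule sum.reindex_bij_witness [of _ "\<lambda>B. (+) r ` B" "\<lambda>A. (\<lambda>x. x - r) ` A"])
  fix A assume "A \<in> {A. A \<in> independent_sets (cycle_power r n) k \<and> A \<inter> {..<r} = {}}"
  then have A: "A \<in> spaced_sets r n k" and ge: "\<forall>x\<in>A. r \<le> x"
    using assms by (auto simp: independent_sets_cycle)
  show shift: "(+) r ` (\<lambda>x. x - r) ` A = A"
    using ge by (rule shift_unshift_image)
  have "inj_on (\<lambda>x. x - r) A"
    using ge by (auto intro!: inj_on_diff_nat)
  moreover have "x - r < n - r" if "x \<in> A" for x
    using that A ge by (force simp: spaced_sets_def)
  moreover have "(x - r) + r < y - r" if "x \<in> A" "y \<in> A" "x - r < y - r" for x y
  proof -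
    have "x + r < y"
      using that A by (auto simp: spaced_sets_def)
    moreover have "r \<le> x" using that ge by blast
    ultimately show ?thesis by simp
  qed
  ultimately show B: "(\<lambda>x. x - r) ` A \<in> spaced_sets r (n - r) k"
    using A by (auto simp: spaced_sets_def card_image)
  then have "card ((\<lambda>x. x - r) ` A) = k" "finite ((\<lambda>x. x - r) ` A)"
    by (auto simp: spaced_sets_def intro: finite_mem_spaced_sets [OF B])
  then have "sum_r r A = int (r * k) + sum_r r ((\<lambda>x. x - r) ` A)"
    using sum_r_shift [of "(\<lambda>x. x - r) ` A" r r] by (simp add: shift)
  then show "q ^ (r * k) * q powi sum_r r ((\<lambda>x. x - r) ` A) = q powi sum_r r A"
    by (simp only: power_int_add [OF disjI1 [OF assms(2)]] power_int_of_nat)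
next
  fix B assume B: "B \<in> spaced_sets r (n - r) k"
  show "(\<lambda>x. x - r) ` (+) r ` B = B"
    by (simp add: image_image)
  have less: "x < n - r" if "x \<in> B" for x
    using B that by (auto simp: spaced_sets_def)
  have "card ((+) r ` B) = k"
    using B unfolding card_shift by (simp add: spaced_sets_def)
  moreover have "(+) r ` B \<subseteq> {0..<n}"
    using less by force
  moreover have "x + r < y \<and> y + r < n + x"
    if mem: "x \<in> (+) r ` B" "y \<in> (+) r ` B" and "x < y" for x y
  proof -
    obtain x' y' where xy: "x = r + x'" "y = r + y'" "x' \<in> B" "y' \<in> B"
      using mem by blast
    with B \<open>x < y\<close> have "x' + r < y'"
      by (simp add: spaced_sets_def)
    with xy less [of y'] show ?thesis
      by simp
  qed
  ultimately show "(+) r ` B \<in> {A. A \<in> independent_sets (cycle_power r n) k \<and> A \<inter> {..<r} = {}}"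
    using assms by (auto simp: independent_sets_cycle spaced_sets_def)
qed

text \<open>
  For \<open>c < r\<close> the gaps from \<open>c\<close>, upwards and around the cycle, leave the window from \<open>c + r + 1\<close>
  to \<open>n + c - r - 1\<close> for the other \<open>k\<close> elements. The weight of the set grows by
  \<open>(c + r + 1) k\<close> from the shift and by \<open>c - (r + 1) k\<close> from inserting \<open>c\<close>, in total by
  \<open>c (k + 1)\<close>. For \<open>n \<le> 2 r\<close> the window is empty, and so is the path with the truncated number
  of vertices.
\<close>

lemma sum_cycle_containing:
  fixes q :: "'a::field"
  assumes "r < n" "c < r" "q \<noteq> 0"
  shows "(\<Sum>A | A \<in> independent_sets (cycle_power r n) (Suc k) \<and> c \<in> A. q powi sum_r r A) =
    q ^ (c * Suc k) * (\<Sum>B\<in>spaced_sets r (n - 1 - 2 * r) k. q powi sum_r r B)"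
  unfolding sum_distrib_left
proof -
  let ?d = "c + r + 1"
  let ?up = "\<lambda>B. insert c ((+) ?d ` B)"
  let ?down = "\<lambda>A. (\<lambda>x. x - ?d) ` (A - {c})"
  show "(\<Sum>A | A \<in> independent_sets (cycle_power r n) (Suc k) \<and> c \<in> A. q powi sum_r r A) =
      (\<Sum>B\<in>spaced_sets r (n - 1 - 2 * r) k. q ^ (c * Suc k) * q powi sum_r r B)"
  proof (rule sum.reindex_bij_witness [of _ ?up ?down])
    fix A assume "A \<in> {A. A \<in> independent_sets (cycle_power r n) (Suc k) \<and> c \<in> A}"
    then have A: "A \<in> spaced_sets r n (Suc k)" and c: "c \<in> A"
      and wrap: "\<And>x y. x \<in> A \<Longrightarrow> y \<in> A \<Longrightarrow> x < y \<Longrightarrow> y + r < n + x"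
      using assms by (auto simp: independent_sets_cycle)
    have gap: "x + r < y" if "x \<in> A" "y \<in> A" "x < y" for x y
      using A that by (auto simp: spaced_sets_def)
    have ge: "?d \<le> x" if "x \<in> A - {c}" for x
      using gap [of x c] gap [of c x] that c \<open>c < r\<close> by (cases x c rule: linorder_cases) auto
    have shift: "(+) ?d ` ?down A = A - {c}"
      using ge by (intro shift_unshift_image) blast
    then show "?up (?down A) = A"
      using c by auto
    have "inj_on (\<lambda>x. x - ?d) (A - {c})"
      using ge by (intro inj_on_diff_nat)
    moreover have "card (A - {c}) = k"
      using A c finite_mem_spaced_sets [OF A] by (simp add: spaced_sets_def)
    moreover have "x - ?d < n - 1 - 2 * r" if "x \<in> A - {c}" for x
      using ge [OF that] wrap [of c x] that c by auto
    then have "?down A \<subseteq> {0..<n - 1 - 2 * r}"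
      by (intro image_subsetI) simp
    moreover have "(x - ?d) + r < y - ?d" if "x \<in> A - {c}" "y \<in> A - {c}" "x - ?d < y - ?d" for x y
    proof -
      have "x < y" using that(3) by linarith
      then show ?thesis
        using gap [of x y] ge [of x] that(1,2) by auto
    qed
    ultimately show B: "?down A \<in> spaced_sets r (n - 1 - 2 * r) k"
      by (simp add: spaced_sets_def card_image)
    then have card: "card (?down A) = k"
      by (simp add: spaced_sets_def)
    have fin: "finite (?down A)"
      using B by (rule finite_mem_spaced_sets)
    have "sum_r r A = sum_r r (insert c ((+) ?d ` ?down A))"
      using c unfolding shift by (simp add: insert_absorb)
    also have "\<dots> = sum_r r ((+) ?d ` ?down A) + int c - (int r + 1) * int k"
    proof -
      have "c \<notin> (+) ?d ` ?down A"
        by auto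
      from sum_r_insert [OF finite_imageI [OF fin] this, of r] show ?thesis
        by (simp only: card_shift card)
    qed
    also have "\<dots> = int (c * Suc k) + sum_r r (?down A)"
      using card unfolding sum_r_shift [OF fin] by (simp add: algebra_simps)
    finally show "q ^ (c * Suc k) * q powi sum_r r (?down A) = q powi sum_r r A"
      by (simp only: power_int_add [OF disjI1 [OF assms(3)]] power_int_of_nat)
  next
    fix B assume B: "B \<in> spaced_sets r (n - 1 - 2 * r) k"
    have "?up B - {c} = (+) ?d ` B"
      by auto
    then show "?down (?up B) = B"
      by (simp add: image_image)
    have less: "x < n - 1 - 2 * r" if "x \<in> B" for x
      using B that by (auto simp: spaced_sets_def)
    have "card (?up B) = Suc k"
    proof -
      have "c \<notin> (+) ?d ` B"
        by auto
      from card_insert_disjoint [OF finite_imageI [OF finite_mem_spaced_sets [OF B]] this]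
      have "card (?up B) = Suc (card B)"
        by (simp only: card_shift)
      then show ?thesis
        using B by (simp add: spaced_sets_def)
    qed
    moreover have "?up B \<subseteq> {0..<n}"
      using assms less by force
    moreover have "x + r < y \<and> y + r < n + x" if mem: "x \<in> ?up B" "y \<in> ?up B" and "x < y" for x y
    proof -
      have "y \<noteq> c"
        using that by auto
      then consider y' where "x = c" "y = ?d + y'" "y' \<in> B"
        | x' y' where "x = ?d + x'" "y = ?d + y'" "x' \<in> B" "y' \<in> B"
        using mem by blast
      then show ?thesis
      proof cases
        case 1
        then show ?thesis using less [of y'] by auto
      next
        case 2
        then show ?thesis
          using less [of y'] B \<open>x < y\<close> by (auto simp: spaced_sets_def)
      qed
    qed
    ultimately show "?up B \<in> {A. A \<in> independent_sets (cycle_power r n) (Suc k) \<and> c \<in> A}"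
      using assms by (auto simp: independent_sets_cycle spaced_sets_def)
  qed
qed

theorem indep_poly_cycle:
  fixes q :: "'a::field"
  assumes "r < n" "q \<noteq> 0" and q_int_nonzero: "q_int q (Suc k) \<noteq> 0"
  shows "indep_poly r (Suc k) (cycle_power r n) q =
    q_int q (r * Suc k) / q_int q (Suc k) *
      indep_poly r k (path_power r (int n - 1 - 2 * int r)) q
    + q ^ (r * Suc k) * indep_poly r (Suc k) (path_power r (int n - int r)) q"
proof -
  let ?I = "independent_sets (cycle_power r n) (Suc k)"
  let ?U = "\<lambda>c. {A. A \<in> ?I \<and> c \<in> A}"
  let ?V = "{A. A \<in> ?I \<and> A \<inter> {..<r} = {}}"
  let ?w = "\<lambda>A. q powi sum_r r A"
  have "finite ?I"
    using finite_spaced_sets assms by (simp add: independent_sets_cycle)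
  then have fin: "finite (?U c)" "finite ?V" for c
    by auto
  have disj: "?U c \<inter> ?U d = {}" if "c < r" "d < r" "c \<noteq> d" for c d
    using that assms(1) by (force simp: independent_sets_cycle spaced_sets_def neq_iff)
  have "?I = (\<Union>c\<in>{..<r}. ?U c) \<union> ?V"
    by auto
  then have "sum ?w ?I = sum ?w ((\<Union>c\<in>{..<r}. ?U c) \<union> ?V)"
    by (rule arg_cong)
  also have "\<dots> = sum ?w (\<Union>c\<in>{..<r}. ?U c) + sum ?w ?V"
    using fin by (intro sum.union_disjoint) auto
  also have "sum ?w (\<Union>c\<in>{..<r}. ?U c) = (\<Sum>c<r. sum ?w (?U c))"
    using fin disj by (intro sum.UNION_disjoint) auto
  also have "\<dots> = (\<Sum>c<r. q ^ (c * Suc k)) * sum ?w (spaced_sets r (n - 1 - 2 * r) k)"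
    using assms by (simp add: sum_cycle_containing sum_distrib_right del: mult_Suc_right)
  also have "(\<Sum>c<r. q ^ (c * Suc k)) = q_int q (r * Suc k) / q_int q (Suc k)"
    using q_int_nonzero q_int_mult_geometric [of q "Suc k" r] by (simp add: field_simps)
  also have "sum ?w ?V = q ^ (r * Suc k) * sum ?w (spaced_sets r (n - r) (Suc k))"
    using assms by (intro sum_cycle_avoiding_initial)
  finally have "sum ?w ?I = q_int q (r * Suc k) / q_int q (Suc k) *
      sum ?w (spaced_sets r (n - 1 - 2 * r) k) +
      q ^ (r * Suc k) * sum ?w (spaced_sets r (n - r) (Suc k))" .
  moreover have "nat (int n - 1 - 2 * int r) = n - 1 - 2 * r" "nat (int n - int r) = n - r"
    by auto
  ultimately show ?thesis
    by (simp only: indep_poly_path_eq_sum) (simp only: indep_poly_def)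
qed

theorem indep_poly_cycle_closed:
  fixes q :: "'a::field"
  assumes "q \<noteq> 0" and q_int_nonzero: "\<And>j. 0 < j \<Longrightarrow> q_int q j \<noteq> 0"
    and "r * Suc k + Suc k \<le> n"
  shows "indep_poly r (Suc k) (cycle_power r n) q =
    q_int q n / q_int q (n - r * Suc k) * q_binomial q (n - r * Suc k) (Suc k)"
proof -
  define N where "N = n - r * Suc k - 1"
  have n: "n = r * Suc k + Suc N" "k \<le> N"
    using assms(3) by (simp_all add: N_def)
  have "r < n"
    using n by simp
  have "indep_poly r k (path_power r (int n - 1 - 2 * int r)) q = q_binomial q N k"
  proof (cases k)
    case 0
    then show ?thesis
      using gauss_0_right [OF q_int_nonzero, of N]
      by (simp add: indep_poly_path_eq_sum spaced_sets_0_right gauss_def)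
  next
    case (Suc k')
    then have le: "1 + 2 * r \<le> n"
      using n by simp
    then have "int n - 1 - 2 * int r = int (n - 1 - 2 * r)"
      by simp
    moreover have "n - 1 - 2 * r + r - r * k = N"
      using n le by simp
    moreover have "r * k + k \<le> n - 1 - 2 * r + r"
      using n le by simp
    ultimately show ?thesis
      using indep_poly_path [OF assms(1) q_int_nonzero, of r k "n - 1 - 2 * r"] by simp
  qed
  moreover have "indep_poly r (Suc k) (path_power r (int n - int r)) q = q_binomial q (Suc N) (Suc k)"
  proof -
    have eqs: "int n - int r = int (n - r)" "n - r + r - r * Suc k = Suc N"
      and "r * Suc k + Suc k \<le> n - r + r"
      using n \<open>r < n\<close> by simp_all
    then show ?thesis
      using indep_poly_path [OF assms(1) q_int_nonzero, of r "Suc k" "n - r"]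
      by (simp only: eqs)
  qed
  moreover have "q_binomial q N k = q_int q (Suc k) / q_int q (Suc N) * q_binomial q (Suc N) (Suc k)"
    using q_binomial_absorb [OF q_int_nonzero, of k N] q_int_nonzero [of "Suc N"]
    by (simp add: nonzero_eq_divide_eq mult.commute)
  ultimately have "indep_poly r (Suc k) (cycle_power r n) q =
      q_int q (r * Suc k) / q_int q (Suc k) *
        (q_int q (Suc k) / q_int q (Suc N) * q_binomial q (Suc N) (Suc k)) +
      q ^ (r * Suc k) * q_binomial q (Suc N) (Suc k)"
    by (simp only: indep_poly_cycle [OF \<open>r < n\<close> assms(1) q_int_nonzero [OF zero_less_Suc]])
  also have "\<dots> = (q_int q (r * Suc k) + q ^ (r * Suc k) * q_int q (Suc N)) / q_int q (Suc N) *
      q_binomial q (Suc N) (Suc k)"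
    using q_int_nonzero [of "Suc k"] q_int_nonzero [of "Suc N"]
    by (simp add: add_divide_distrib distrib_right del: mult_Suc_right power_Suc)
  also have "q_int q (r * Suc k) + q ^ (r * Suc k) * q_int q (Suc N) = q_int q n"
    unfolding n(1) by (rule q_int_add [symmetric])
  also have "Suc N = n - r * Suc k"
    using n by simp
  finally show ?thesis .
qed

section \<open>The indeterminate\<close>

lemma q_int_qvar: "q_int qvar m = Fraction_Field.Fract (\<Sum>j<m. monom 1 j) 1"
proof -
  have "qvar ^ j = Fraction_Field.Fract (monom 1 j) 1" for j
    by (induction j) (simp_all add: qvar_def One_fract_def monom_Suc)
  then show ?thesis
    unfolding q_int_def by (induction m) (simp_all add: Zero_fract_def)
qed

lemma qvar_nonzero: "qvar \<noteq> 0"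
  by (simp add: qvar_def Zero_fract_def eq_fract)

text \<open>The numerator of \<open>[m]\<close> takes the value \<open>m\<close> at \<open>1\<close>.\<close>

lemma q_int_qvar_nonzero:
  assumes "0 < m"
  shows "q_int qvar m \<noteq> 0"
proof -
  have "poly (\<Sum>j<m. monom 1 j) (1::int) = int m"
    by (simp add: poly_sum poly_monom)
  with assms have "(\<Sum>j<m. monom 1 j) \<noteq> (0 :: int poly)"
    by (metis of_nat_0_less_iff less_irrefl poly_0)
  then show ?thesis
    by (simp add: q_int_qvar Zero_fract_def eq_fract)
qed

theorem proposition5:
  fixes r n k :: nat
  assumes "0 < r" and "0 < n" and "r \<le> n"
    and "0 < k" and "real k \<le> real n / (real r + 1)"
  shows "indep_poly r k (path_power r (int n)) qvar = q_binomial qvar (n - r * k + r) k \<and>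
         indep_poly r k (cycle_power r n) qvar =
           q_int qvar (r * k) / q_int qvar k *
             indep_poly r (k - 1) (path_power r (int n - 1 - 2 * int r)) qvar
           + qvar ^ (r * k) * indep_poly r k (path_power r (int n - int r)) qvar \<and>
         indep_poly r k (cycle_power r n) qvar =
           q_int qvar n / q_int qvar (n - r * k) * q_binomial qvar (n - r * k) k"
proof -
  obtain k' where k: "k = Suc k'"
    using assms(4) by (cases k) auto
  have "real (r * k + k) \<le> real n"
    using assms(5) by (simp add: field_simps)
  then have le: "r * k + k \<le> n"
    by (simp only: of_nat_le_iff)
  then have "r < n"
    by (simp add: k)
  have "n + r - r * k = n - r * k + r"
    using le by simp
  then have "indep_poly r k (path_power r (int n)) qvar = q_binomial qvar (n - r * k + r) k"
    using indep_poly_path [OF qvar_nonzero q_int_qvar_nonzero, of r k n] le by simp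
  moreover have "indep_poly r k (cycle_power r n) qvar =
      q_int qvar (r * k) / q_int qvar k *
        indep_poly r (k - 1) (path_power r (int n - 1 - 2 * int r)) qvar
      + qvar ^ (r * k) * indep_poly r k (path_power r (int n - int r)) qvar"
    using indep_poly_cycle [OF \<open>r < n\<close> qvar_nonzero q_int_qvar_nonzero, of k']
    by (simp add: k del: mult_Suc_right)
  moreover have "indep_poly r k (cycle_power r n) qvar =
      q_int qvar n / q_int qvar (n - r * k) * q_binomial qvar (n - r * k) k"
    using indep_poly_cycle_closed [OF qvar_nonzero q_int_qvar_nonzero, of r k' n] le
    by (simp add: k del: mult_Suc_right)
  ultimately show ?thesis
    by blast
qed

end
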